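(* Let $X$ be a path-connected topological group (whose underlying space is an ANR). Then $\mathsf{iTC}(X)=\mathsf{icat}(X)$.
   Context: $I=[0,1]$. For a metric space $Z$ and $n\ge 1$, $\mathcal B_n(Z)$ is the space of probability measures on $Z$ whose support has at most $n$ points, written as finite formal convex combinations $\sum\lambda_z z$ with $\lambda_z>0$, $\sum\lambda_z=1$, equipped with the Lévy–Prokhorov metric; $\delta_z$ is the Dirac measure at $z$. $P(Z)$ is the space of continuous paths $I\to Z$ with the compact-open topology. Define $\Phi_n:\mathcal B_n(P(X))\to P(\mathcal B_n(X))$ by $\Phi_n(\sum\lambda_\alpha\alpha)(t)=\sum\lambda_\alpha\alpha(t)$. A path $f\in P(\mathcal B_n(X))$ is resolvable if $f=\Phi_n(\mu)$ for some $\mu\in\mathcal B_n(P(X))$; $RP(\mathcal B_n(X))\subset P(\mathcal B_n(X))$ is the subspace of resolvable paths. Given a basepoint $x_0\in X$, $RP_0(\mathcal B_k(X))=\{f\in RP(\mathcal B_k(X)) : f(1)=\delta_{x_0}\}$. $\mathsf{iTC}(X)$ is the minimal integer $n\ge 0$ such that there is a continuous map $s:X\times X\to RP(\mathcal B_{n+1}(X))$ with $s(x,y)(0)=\delta_x$ and $s(x,y)(1)=\delta_y$ for all $(x,y)\in X\times X$. $\mathsf{icat}(X)$ is the minimal integer $n\ge 0$ such that there is a continuous $H:X\to RP_0(\mathcal B_{n+1}(X))$ with $H(x)(0)=\delta_x$ for all $x\in X$. (Both are infinite if no such $n$ exists.) *)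

theory Defs
  imports
    "HOL-Analysis.Analysis"
    "HOL-Probability.Probability_Mass_Function"
    "HOL-Library.Extended_Nat"
begin

section \<open>Finitely supported probability measures\<close>

text \<open>
  A finite convex combination of points is a \<open>pmf\<close> with finite support: the coefficient
  of \<open>z\<close> is \<open>pmf \<mu> z\<close> and the Dirac measure at \<open>z\<close> is \<open>return_pmf z\<close>.
\<close>

definition fin_measures :: "nat \<Rightarrow> 'a set \<Rightarrow> 'a pmf set" where
  "fin_measures n Z = {\<mu>. finite (set_pmf \<mu>) \<and> card (set_pmf \<mu>) \<le> n \<and> set_pmf \<mu> \<subseteq> Z}"

definition thicken :: "real \<Rightarrow> 'a::metric_space set \<Rightarrow> 'a set" where
  "thicken \<epsilon> A = (\<Union>a\<in>A. ball a \<epsilon>)"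

definition prokhorov_bound :: "'a::metric_space pmf \<Rightarrow> 'a pmf \<Rightarrow> real \<Rightarrow> bool" where
  "prokhorov_bound \<mu> \<nu> \<epsilon> \<longleftrightarrow> 0 < \<epsilon> \<and> (\<forall>A \<in> sets borel.
      measure_pmf.prob \<mu> A \<le> measure_pmf.prob \<nu> (thicken \<epsilon> A) + \<epsilon> \<and>
      measure_pmf.prob \<nu> A \<le> measure_pmf.prob \<mu> (thicken \<epsilon> A) + \<epsilon>)"

definition prokhorov_dist :: "'a::metric_space pmf \<Rightarrow> 'a pmf \<Rightarrow> real" where
  "prokhorov_dist \<mu> \<nu> = Inf {\<epsilon>. prokhorov_bound \<mu> \<nu> \<epsilon>}"

definition fin_measures_top :: "nat \<Rightarrow> 'a::metric_space set \<Rightarrow> 'a pmf topology" where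
  "fin_measures_top n Z = Metric_space.mtopology (fin_measures n Z) prokhorov_dist"

lemma open_thicken: "open (thicken \<epsilon> A)"
  unfolding thicken_def by auto

lemma prokhorov_bound_one: "prokhorov_bound \<mu> \<nu> 1"
  unfolding prokhorov_bound_def
  by (auto intro: order_trans[OF measure_pmf.prob_le_1])

lemma prokhorov_bound_commute: "prokhorov_bound \<mu> \<nu> = prokhorov_bound \<nu> \<mu>"
  unfolding prokhorov_bound_def by (intro ext) auto

lemma bdd_below_prokhorov: "bdd_below {\<epsilon>. prokhorov_bound \<mu> \<nu> \<epsilon>}"
  by (rule bdd_belowI[of _ 0]) (auto simp: prokhorov_bound_def)

lemma prokhorov_dist_le: "prokhorov_bound \<mu> \<nu> \<epsilon> \<Longrightarrow> prokhorov_dist \<mu> \<nu> \<le> \<epsilon>"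
  unfolding prokhorov_dist_def by (rule cInf_lower) (auto simp: bdd_below_prokhorov)

lemma prokhorov_dist_nonneg: "0 \<le> prokhorov_dist \<mu> \<nu>"
proof -
  have "{\<epsilon>. prokhorov_bound \<mu> \<nu> \<epsilon>} \<noteq> {}" using prokhorov_bound_one by blast
  then show ?thesis
    unfolding prokhorov_dist_def by (rule cInf_greatest) (simp add: prokhorov_bound_def)
qed

lemma prokhorov_dist_lessE:
  assumes "prokhorov_dist \<mu> \<nu> < e"
  obtains \<epsilon> where "prokhorov_bound \<mu> \<nu> \<epsilon>" "\<epsilon> < e"
proof -
  have "{\<epsilon>. prokhorov_bound \<mu> \<nu> \<epsilon>} \<noteq> {}" using prokhorov_bound_one by blast
  then show thesis
    using assms that unfolding prokhorov_dist_def
    by (metis bdd_below_prokhorov cInf_less_iff mem_Collect_eq)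
qed

lemma prokhorov_bound_refl: "0 < \<epsilon> \<Longrightarrow> prokhorov_bound \<mu> \<mu> \<epsilon>"
proof -
  assume e: "0 < \<epsilon>"
  have "measure_pmf.prob \<mu> A \<le> measure_pmf.prob \<mu> (thicken \<epsilon> A)" for A
    using e by (intro measure_pmf.finite_measure_mono) (auto simp: thicken_def)
  then show ?thesis using e unfolding prokhorov_bound_def by (auto intro: add_increasing2)
qed

lemma prokhorov_half_trans:
  assumes "prokhorov_bound \<mu> \<nu> d" "prokhorov_bound \<nu> \<xi> e" "A \<in> sets borel"
  shows "measure_pmf.prob \<mu> A \<le> measure_pmf.prob \<xi> (thicken (d + e) A) + (d + e)"
proof -
  have "thicken e (thicken d A) \<subseteq> thicken (d + e) A"
  proof
    fix x assume "x \<in> thicken e (thicken d A)"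
    then obtain y a where "dist y x < e" "dist a y < d" "a \<in> A"
      by (auto simp: thicken_def)
    moreover have "dist a x \<le> dist a y + dist y x" by (rule dist_triangle)
    ultimately show "x \<in> thicken (d + e) A" by (force simp: thicken_def)
  qed
  then have "measure_pmf.prob \<xi> (thicken e (thicken d A)) \<le> measure_pmf.prob \<xi> (thicken (d + e) A)"
    by (intro measure_pmf.finite_measure_mono) auto
  moreover have "measure_pmf.prob \<mu> A \<le> measure_pmf.prob \<nu> (thicken d A) + d"
    using assms unfolding prokhorov_bound_def by blast
  moreover have "measure_pmf.prob \<nu> (thicken d A) \<le> measure_pmf.prob \<xi> (thicken e (thicken d A)) + e"
    using assms(2) borel_open[OF open_thicken] unfolding prokhorov_bound_def by blast
  ultimately show ?thesis by linarith
qed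

lemma prokhorov_bound_trans:
  assumes "prokhorov_bound \<mu> \<nu> d" "prokhorov_bound \<nu> \<xi> e"
  shows "prokhorov_bound \<mu> \<xi> (d + e)"
  using prokhorov_half_trans[OF assms]
    prokhorov_half_trans[OF assms(2)[unfolded prokhorov_bound_commute[of \<nu> \<xi>]]
      assms(1)[unfolded prokhorov_bound_commute[of \<mu> \<nu>]]] assms
  by (auto simp: prokhorov_bound_def add.commute[of e d])

lemma prokhorov_dist_zero_pmf_le:
  assumes "prokhorov_dist \<mu> \<nu> = 0" "finite (set_pmf \<nu>)"
  shows "pmf \<mu> x \<le> pmf \<nu> x"
proof (rule field_le_epsilon)
  fix e :: real assume e: "0 < e"
  obtain r where r: "r > 0" "\<forall>y\<in>set_pmf \<nu>. y \<noteq> x \<longrightarrow> r \<le> dist x y"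
    using finite_set_avoid[OF assms(2), of x] by blast
  have "prokhorov_dist \<mu> \<nu> < min r e" using assms(1) r(1) e by simp
  then obtain d where d: "prokhorov_bound \<mu> \<nu> d" "d < min r e"
    by (rule prokhorov_dist_lessE)
  have "measure_pmf.prob \<mu> {x} \<le> measure_pmf.prob \<nu> (thicken d {x}) + d"
    using d(1) borel_singleton[OF sets.empty_sets, of x] unfolding prokhorov_bound_def by blast
  also have "measure_pmf.prob \<nu> (thicken d {x}) = measure_pmf.prob \<nu> (thicken d {x} \<inter> set_pmf \<nu>)"
    by (simp add: measure_Int_set_pmf)
  also have "\<dots> \<le> measure_pmf.prob \<nu> {x}"
    using r(2) d(2) by (intro measure_pmf.finite_measure_mono) (force simp: thicken_def)+
  finally show "pmf \<mu> x \<le> pmf \<nu> x + e" using d(2) by (simp add: measure_pmf_single)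
qed

lemma Metric_space_fin_measures: "Metric_space (fin_measures n Z) prokhorov_dist"
proof
  show "0 \<le> prokhorov_dist \<mu> \<nu>" for \<mu> \<nu> :: "'a pmf"
    by (rule prokhorov_dist_nonneg)
  show sym: "prokhorov_dist \<mu> \<nu> = prokhorov_dist \<nu> \<mu>" for \<mu> \<nu> :: "'a pmf"
    unfolding prokhorov_dist_def by (subst prokhorov_bound_commute) (rule refl)
  show "prokhorov_dist \<mu> \<nu> = 0 \<longleftrightarrow> \<mu> = \<nu>"
    if "\<mu> \<in> fin_measures n Z" "\<nu> \<in> fin_measures n Z" for \<mu> \<nu>
  proof
    assume "prokhorov_dist \<mu> \<nu> = 0"
    moreover from this sym have "prokhorov_dist \<nu> \<mu> = 0" by metis
    moreover have "finite (set_pmf \<mu>)" "finite (set_pmf \<nu>)"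
      using that by (auto simp: fin_measures_def)
    ultimately show "\<mu> = \<nu>"
      by (metis prokhorov_dist_zero_pmf_le antisym pmf_eqI)
  next
    assume "\<mu> = \<nu>"
    have "prokhorov_dist \<nu> \<nu> \<le> 0"
      by (rule field_le_epsilon) (simp add: prokhorov_bound_refl prokhorov_dist_le)
    then show "prokhorov_dist \<mu> \<nu> = 0"
      using prokhorov_dist_nonneg[of \<nu> \<nu>] \<open>\<mu> = \<nu>\<close> by simp
  qed
  show "prokhorov_dist \<mu> \<xi> \<le> prokhorov_dist \<mu> \<nu> + prokhorov_dist \<nu> \<xi>" for \<mu> \<nu> \<xi> :: "'a pmf"
  proof (rule field_le_epsilon)
    fix e :: real assume "0 < e"
    then have "prokhorov_dist \<mu> \<nu> < prokhorov_dist \<mu> \<nu> + e/2"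
        "prokhorov_dist \<nu> \<xi> < prokhorov_dist \<nu> \<xi> + e/2" by simp_all
    then obtain a b where "prokhorov_bound \<mu> \<nu> a" "a < prokhorov_dist \<mu> \<nu> + e/2"
        "prokhorov_bound \<nu> \<xi> b" "b < prokhorov_dist \<nu> \<xi> + e/2"
      by (elim prokhorov_dist_lessE) blast
    then show "prokhorov_dist \<mu> \<xi> \<le> prokhorov_dist \<mu> \<nu> + prokhorov_dist \<nu> \<xi> + e"
      using prokhorov_dist_le[OF prokhorov_bound_trans, of \<mu> \<nu> a \<xi> b] by linarith
  qed
qed

section \<open>Path spaces\<close>

text \<open>Extensionality makes a path determined by its restriction to \<open>{0..1}\<close>.\<close>

definition path_space :: "'b topology \<Rightarrow> (real \<Rightarrow> 'b) set" where
  "path_space Z = {f \<in> extensional {0..1}. pathin Z f}"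

definition compact_open_top :: "'b topology \<Rightarrow> (real \<Rightarrow> 'b) topology" where
  "compact_open_top Z = subtopology
     (topology_generated_by
        {{f. f ` K \<subseteq> U} | K U. compact K \<and> K \<subseteq> {0..1} \<and> openin Z U})
     (path_space Z)"

definition Phi :: "(real \<Rightarrow> 'a) pmf \<Rightarrow> real \<Rightarrow> 'a pmf" where
  "Phi \<mu> = (\<lambda>t\<in>{0..1}. map_pmf (\<lambda>\<alpha>. \<alpha> t) \<mu>)"

definition resolvable_paths :: "nat \<Rightarrow> 'a::metric_space set \<Rightarrow> (real \<Rightarrow> 'a pmf) set" where
  "resolvable_paths n X =
     {f \<in> path_space (fin_measures_top n X).
        \<exists>\<mu> \<in> fin_measures n (path_space (top_of_set X)). f = Phi \<mu>}"

definition RP :: "nat \<Rightarrow> 'a::metric_space set \<Rightarrow> (real \<Rightarrow> 'a pmf) topology" where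
  "RP n X = subtopology (compact_open_top (fin_measures_top n X)) (resolvable_paths n X)"

definition RP0 :: "nat \<Rightarrow> 'a::metric_space set \<Rightarrow> 'a \<Rightarrow> (real \<Rightarrow> 'a pmf) topology" where
  "RP0 n X x\<^sub>0 = subtopology (RP n X) {f. f 1 = return_pmf x\<^sub>0}"

section \<open>Intertwining invariants\<close>

text \<open>In \<^typ>\<open>enat\<close> the infimum of the empty set is \<open>\<infinity>\<close>.\<close>

definition iTC :: "'a::metric_space set \<Rightarrow> enat" where
  "iTC X = Inf (enat ` {n. \<exists>s.
     continuous_map (prod_topology (top_of_set X) (top_of_set X)) (RP (n + 1) X) s \<and>
     (\<forall>x\<in>X. \<forall>y\<in>X. s (x, y) 0 = return_pmf x \<and> s (x, y) 1 = return_pmf y)})"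

definition icat :: "'a::metric_space set \<Rightarrow> 'a \<Rightarrow> enat" where
  "icat X x\<^sub>0 = Inf (enat ` {n. \<exists>H.
     continuous_map (top_of_set X) (RP0 (n + 1) X x\<^sub>0) H \<and>
     (\<forall>x\<in>X. H x 0 = return_pmf x)})"

section \<open>Absolute neighbourhood retracts\<close>

text \<open>
  A metrizable space is an ANR if each closed homeomorphic copy of it in a metrizable space is
  a retract of a neighbourhood. HOL cannot quantify over the carrier types of the
  ambient spaces, so they range over the metrizable topologies on arbitrary subsets of
  \<^typ>\<open>'a \<Rightarrow> real\<close>. This loses nothing: by the Kuratowski--Wojdyslawski theorem, a metrizable
  space on points of \<^typ>\<open>'a\<close> embeds as a closed subset of a convex set in a normed space of bounded
  real functions on it, and convex sets in normed spaces are absolute extensors for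
  metrizable spaces (Dugundji). The library's \<^const>\<open>ANR\<close> admits only ambient spaces inside
  \<^typ>\<open>'a \<times> real\<close> with the product topology and is intended for Euclidean spaces.
\<close>

definition metrizable_ANR :: "'a topology \<Rightarrow> bool" where
  "metrizable_ANR X \<longleftrightarrow> metrizable_space X \<and>
     (\<forall>(Y :: ('a \<Rightarrow> real) topology) C.
        metrizable_space Y \<and> closedin Y C \<and> X homeomorphic_space (subtopology Y C) \<longrightarrow>
        (\<exists>U. openin Y U \<and> C \<subseteq> U \<and> C retract_of_space (subtopology Y U)))"

end

theory Submission
  imports Defs
begin

text \<open>
  Taking the constant endpoint \<open>x\<^sub>0\<close> in a motion planner \<open>s\<close> gives a contraction
  \<open>x \<mapsto> s (x, x\<^sub>0)\<close>, so \<open>icat \<le> iTC\<close> on any space. In a group the converse holds because one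
  contraction can be moved to every endpoint by translation. Let \<open>H w\<close> be a resolvable path from
  the Dirac measure at \<open>w\<close> to the one at \<open>x\<^sub>0\<close>. Pushing it forward along the right translation
  \<open>z \<mapsto> z + c\<close> gives a path from \<open>w + c\<close> to \<open>x\<^sub>0 + c\<close>. The choice \<open>c = - x\<^sub>0 + y\<close> makes the end
  equal to \<open>y\<close>, and then \<open>w = x - y + x\<^sub>0\<close> makes the start equal to \<open>x\<close>.

  What has to be checked is that the translated path depends continuously on \<open>c\<close> and on the given
  path. The metric is an arbitrary one inducing the topology, so translations need not be
  uniformly continuous, let alone isometries. Pushforward is nevertheless jointly continuous
  in the Levy--Prokhorov metric (\<open>continuous_map_pushforward\<close>): near a finitely supported
  measure, only the continuity of the translations at its finitely many support points matters.
  A jointly continuous family of maps acts jointly continuously on paths in the compact-open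
  topology (\<open>continuous_map_compose_paths\<close>). Resolvability is preserved because the pushforward can
  be performed on the measure on paths.
\<close>

section \<open>Pushforward in the Levy--Prokhorov metric\<close>

text \<open>
  The second inequality at \<open>A\<close> is the first one at the complement of the thickening of \<open>A\<close>, whose
  own thickening misses \<open>A\<close>.
\<close>

lemma prokhorov_bound_one_sided:
  assumes "0 < \<epsilon>"
    and le: "\<And>A. A \<in> sets borel \<Longrightarrow>
      measure_pmf.prob \<mu> A \<le> measure_pmf.prob \<nu> (thicken \<epsilon> A) + \<epsilon>"
  shows "prokhorov_bound \<mu> \<nu> \<epsilon>"
proof -
  have "measure_pmf.prob \<nu> A \<le> measure_pmf.prob \<mu> (thicken \<epsilon> A) + \<epsilon>" for A
  proof -
    define B where "B = - thicken \<epsilon> A"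
    have "B \<in> sets borel"
      unfolding B_def by (intro borel_closed closed_Compl open_thicken)
    then have "measure_pmf.prob \<mu> B \<le> measure_pmf.prob \<nu> (thicken \<epsilon> B) + \<epsilon>"
      by (rule le)
    moreover have "measure_pmf.prob \<mu> B = 1 - measure_pmf.prob \<mu> (thicken \<epsilon> A)"
      using measure_pmf.prob_compl[of "thicken \<epsilon> A" \<mu>] by (simp add: B_def Compl_eq_Diff_UNIV)
    moreover have "measure_pmf.prob \<nu> (thicken \<epsilon> B) \<le> measure_pmf.prob \<nu> (- A)"
    proof (intro measure_pmf.finite_measure_mono)
      show "thicken \<epsilon> B \<subseteq> - A"
        unfolding B_def thicken_def by (auto, metis dist_commute)
    qed simp
    moreover have "measure_pmf.prob \<nu> (- A) = 1 - measure_pmf.prob \<nu> A"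
      using measure_pmf.prob_compl[of A \<nu>] by (simp add: Compl_eq_Diff_UNIV)
    ultimately show ?thesis by linarith
  qed
  then show ?thesis
    using assms unfolding prokhorov_bound_def by blast
qed

lemma topspace_fin_measures_top [simp]: "topspace (fin_measures_top n Z) = fin_measures n Z"
  unfolding fin_measures_top_def
  by (rule Metric_space.topspace_mtopology[OF Metric_space_fin_measures])

lemma map_pmf_in_fin_measures:
  assumes "\<mu> \<in> fin_measures n Z" "f ` Z \<subseteq> W"
  shows "map_pmf f \<mu> \<in> fin_measures n W"
  using assms card_image_le[of "set_pmf \<mu>" f] by (auto simp: fin_measures_def)

text \<open>
  Up to an error, a measure \<open>\<nu>\<close> near \<open>\<mu>\<close> puts the mass of each set of support points of \<open>\<mu>\<close> close to
  that set. So the pushforwards are close as soon as, near each of those points \<open>z\<close>, the map \<open>g\<close>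
  stays within \<open>\<epsilon>\<close> of the single value \<open>f z\<close>.
\<close>

lemma prokhorov_bound_map_pmf:
  assumes "prokhorov_bound \<mu> \<nu> d" "d \<le> \<epsilon>" "finite (set_pmf \<mu>)"
    and close: "\<And>z w. z \<in> set_pmf \<mu> \<Longrightarrow> w \<in> set_pmf \<nu> \<Longrightarrow> dist z w < d \<Longrightarrow> dist (f z) (g w) < \<epsilon>"
  shows "prokhorov_bound (map_pmf f \<mu>) (map_pmf g \<nu>) \<epsilon>"
proof (rule prokhorov_bound_one_sided)
  show "0 < \<epsilon>" using assms(1,2) by (simp add: prokhorov_bound_def)
  fix A
  \<comment> \<open>\<open>f\<close> may fail to be measurable, but cutting down to the support leaves a finite set, whose
    thickening only sees points near the support.\<close>
  define F where "F = set_pmf \<mu> \<inter> f -` A"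
  have "F \<in> sets borel"
    using assms(3) by (intro borel_closed finite_imp_closed) (simp add: F_def)
  have "measure_pmf.prob (map_pmf f \<mu>) A = measure_pmf.prob \<mu> F"
    using measure_Int_set_pmf[of \<mu> "f -` A"] by (simp add: F_def Int_commute)
  also have "\<dots> \<le> measure_pmf.prob \<nu> (thicken d F) + d"
    using assms(1) \<open>F \<in> sets borel\<close> unfolding prokhorov_bound_def by blast
  also have "measure_pmf.prob \<nu> (thicken d F) = measure_pmf.prob \<nu> (thicken d F \<inter> set_pmf \<nu>)"
    by (simp add: measure_Int_set_pmf)
  also have "\<dots> \<le> measure_pmf.prob \<nu> (g -` thicken \<epsilon> A)"
    using close by (intro measure_pmf.finite_measure_mono) (fastforce simp: thicken_def F_def)+
  finally show "measure_pmf.prob (map_pmf f \<mu>) A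
      \<le> measure_pmf.prob (map_pmf g \<nu>) (thicken \<epsilon> A) + \<epsilon>"
    using assms(2) by simp
qed

text \<open>
  Finiteness of the support enters here: it yields one radius and one neighbourhood of the
  parameter that serve all support points.
\<close>

lemma continuous_map_pushforward:
  fixes g :: "'b::topological_space \<times> 'a::metric_space \<Rightarrow> 'c::metric_space"
  assumes g: "continuous_on (C \<times> Z) g" "g ` (C \<times> Z) \<subseteq> W"
  shows "continuous_map (prod_topology (top_of_set C) (fin_measures_top n Z)) (fin_measures_top n W)
    (\<lambda>(c, \<mu>). map_pmf (\<lambda>z. g (c, z)) \<mu>)"
    (is "continuous_map ?T _ ?G")
  unfolding fin_measures_top_def[of n W]
    Metric_space.continuous_map_to_metric[OF Metric_space_fin_measures]
proof (intro ballI allI impI)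
  interpret M: Metric_space "fin_measures n W" prokhorov_dist
    by (rule Metric_space_fin_measures)
  interpret N: Metric_space "fin_measures n Z" prokhorov_dist
    by (rule Metric_space_fin_measures)
  fix p and \<epsilon> :: real
  assume p: "p \<in> topspace ?T" and \<epsilon>: "0 < \<epsilon>"
  obtain c \<mu> where p_def: "p = (c, \<mu>)" by (cases p)
  from p have c: "c \<in> C" and \<mu>: "\<mu> \<in> fin_measures n Z" by (auto simp: p_def)
  then have fin: "finite (set_pmf \<mu>)" and sub: "set_pmf \<mu> \<subseteq> Z" by (auto simp: fin_measures_def)
  have "\<exists>V r. open V \<and> c \<in> V \<and> 0 < r \<and>
      (\<forall>b \<in> C \<inter> V. \<forall>w \<in> Z. dist z w < r \<longrightarrow> dist (g (c, z)) (g (b, w)) < \<epsilon>/2)"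
    if "z \<in> set_pmf \<mu>" for z
  proof -
    have "(c, z) \<in> C \<times> Z" using c sub that by auto
    moreover have "g (c, z) \<in> ball (g (c, z)) (\<epsilon>/2)" using \<epsilon> by simp
    ultimately obtain S where S: "open S" "(c, z) \<in> S"
        "\<And>q. q \<in> C \<times> Z \<Longrightarrow> q \<in> S \<Longrightarrow> g q \<in> ball (g (c, z)) (\<epsilon>/2)"
      using g(1) unfolding continuous_on_topological by (metis open_ball)
    from open_prod_elim[OF S(1,2)] obtain V B where VB: "open V" "open B"
        "(c, z) \<in> V \<times> B" "V \<times> B \<subseteq> S" by blast
    then obtain r where r: "0 < r" "ball z r \<subseteq> B"
      by (meson mem_Sigma_iff open_contains_ball)
    have "dist (g (c, z)) (g (b, w)) < \<epsilon>/2" if "b \<in> C \<inter> V" "w \<in> Z" "dist z w < r" for b w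
    proof -
      have "(b, w) \<in> S" using that VB(4) r(2) by (auto simp: subset_iff)
      then show ?thesis using S(3)[of "(b, w)"] that by simp
    qed
    then show ?thesis using VB(1,3) r(1) by blast
  qed
  then obtain V r where V: "\<And>z. z \<in> set_pmf \<mu> \<Longrightarrow> open (V z) \<and> c \<in> V z \<and> 0 < r z"
    and close: "\<And>z b w. z \<in> set_pmf \<mu> \<Longrightarrow> b \<in> C \<inter> V z \<Longrightarrow> w \<in> Z \<Longrightarrow> dist z w < r z \<Longrightarrow>
      dist (g (c, z)) (g (b, w)) < \<epsilon>/2"
    by metis
  define V0 where "V0 = (\<Inter>z \<in> set_pmf \<mu>. V z)"
  define r0 where "r0 = Min (insert (\<epsilon>/2) (r ` set_pmf \<mu>))"
  have V0: "open V0" "c \<in> V0" using fin V by (auto simp: V0_def)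
  have r0: "0 < r0" "r0 \<le> \<epsilon>/2" "\<And>z. z \<in> set_pmf \<mu> \<Longrightarrow> r0 \<le> r z"
  proof -
    show "0 < r0" using fin V \<epsilon> by (simp add: r0_def)
    show "r0 \<le> \<epsilon>/2" unfolding r0_def using fin by (intro Min_le) auto
    show "r0 \<le> r z" if "z \<in> set_pmf \<mu>" for z unfolding r0_def using fin that by (intro Min_le) auto
  qed
  have "?G q \<in> M.mball (?G p) \<epsilon>" if "q \<in> (C \<inter> V0) \<times> N.mball \<mu> r0" for q
  proof -
    obtain b \<nu> where q: "q = (b, \<nu>)" by (cases q)
    with that have b: "b \<in> C" "b \<in> V0" and \<nu>: "\<nu> \<in> fin_measures n Z" "prokhorov_dist \<mu> \<nu> < r0"
      by auto
    obtain d where d: "prokhorov_bound \<mu> \<nu> d" "d < r0" using \<nu>(2) by (rule prokhorov_dist_lessE)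
    have "prokhorov_bound (map_pmf (\<lambda>z. g (c, z)) \<mu>) (map_pmf (\<lambda>z. g (b, z)) \<nu>) (\<epsilon>/2)"
    proof (rule prokhorov_bound_map_pmf[OF d(1) _ fin])
      show "d \<le> \<epsilon>/2" using d(2) r0(2) by simp
      show "dist (g (c, z)) (g (b, w)) < \<epsilon>/2"
        if "z \<in> set_pmf \<mu>" "w \<in> set_pmf \<nu>" "dist z w < d" for z w
        using that b \<nu>(1) d(2) r0(3)[of z]
        by (intro close) (auto simp: V0_def fin_measures_def)
    qed
    then have "prokhorov_dist (?G p) (?G q) < \<epsilon>"
      using prokhorov_dist_le \<epsilon> by (fastforce simp: p_def q)
    moreover have "?G p \<in> fin_measures n W" "?G q \<in> fin_measures n W"
      using g(2) c b \<mu> \<nu>(1) by (auto simp: p_def q intro!: map_pmf_in_fin_measures)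
    ultimately show ?thesis by simp
  qed
  moreover have "openin ?T ((C \<inter> V0) \<times> N.mball \<mu> r0)"
    using V0 by (simp add: openin_prod_Times_iff fin_measures_top_def openin_open_Int)
  moreover have "p \<in> (C \<inter> V0) \<times> N.mball \<mu> r0"
    using c \<mu> V0 r0(1) by (simp add: p_def)
  ultimately show "\<exists>U. openin ?T U \<and> p \<in> U \<and> (\<forall>q\<in>U. ?G q \<in> M.mball (?G p) \<epsilon>)"
    by blast
qed

section \<open>Families of maps acting on paths\<close>

lemma topspace_compact_open_top [simp]: "topspace (compact_open_top Z) = path_space Z"
proof -
  have "f \<in> \<Union> {{f. f ` K \<subseteq> U} | K U. compact K \<and> K \<subseteq> {0..1} \<and> openin Z U}" for f
    by (rule UnionI[of "{f. f ` {} \<subseteq> {}}"]) (auto intro!: exI[of _ "{}"])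
  then show ?thesis unfolding compact_open_top_def by auto
qed

lemma openin_compact_open_top:
  assumes "compact K" "K \<subseteq> {0..1}" "openin Z U"
  shows "openin (compact_open_top Z) {f \<in> path_space Z. f ` K \<subseteq> U}"
  unfolding compact_open_top_def openin_subtopology
  using assms by (intro exI[of _ "{f. f ` K \<subseteq> U}"]) (auto intro!: topology_generated_by_Basis)

lemma path_space_compose_family:
  assumes "continuous_map (prod_topology T Z) W m" "c \<in> topspace T" "f \<in> path_space Z"
  shows "(\<lambda>t\<in>{0..1}. m (c, f t)) \<in> path_space W"
proof -
  have "continuous_map (top_of_set {0..1}) (prod_topology T Z) (\<lambda>t. (c, f t))"
    using assms(2,3) by (auto intro!: continuous_map_pairedI simp: path_space_def pathin_def)
  then have "continuous_map (top_of_set {0..1}) W (\<lambda>t. m (c, f t))"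
    using continuous_map_compose[OF _ assms(1)] by (auto simp: o_def)
  then show ?thesis
    by (auto simp: path_space_def pathin_def intro: continuous_map_eq)
qed

text \<open>
  For a subbasic condition on \<open>K\<close>, each parameter time has a compact neighbourhood in \<open>K\<close> that the
  path keeps inside one factor of a product neighbourhood. Finitely many of these cover \<open>K\<close>, so
  finitely many conditions on the path and on the parameter suffice.
\<close>

lemma continuous_map_compose_paths:
  assumes m: "continuous_map (prod_topology T Z) W m"
  shows "continuous_map (prod_topology T (compact_open_top Z)) (compact_open_top W)
    (\<lambda>(c, f). \<lambda>t\<in>{0..1}. m (c, f t))"
    (is "continuous_map ?T _ ?G")
proof -
  have path: "?G q \<in> path_space W" if "q \<in> topspace ?T" for q
    using that path_space_compose_family[OF m] by auto
  have nbhd: "\<exists>N. openin ?T N \<and> p \<in> N \<and> (\<forall>q \<in> N. ?G q ` K \<subseteq> U)"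
    if K: "compact K" "K \<subseteq> {0..1}" and U: "openin W U" and p: "p \<in> topspace ?T" "?G p ` K \<subseteq> U"
    for K U p
  proof -
    obtain c f where p_def: "p = (c, f)" by (cases p)
    from p(1) have c: "c \<in> topspace T" and f: "f \<in> path_space Z" by (auto simp: p_def)
    then have contf: "continuous_map (top_of_set {0..1}) Z f"
      by (simp add: path_space_def pathin_def)
    have "\<exists>V B r. openin T V \<and> c \<in> V \<and> openin Z B \<and> 0 < r \<and> f ` (K \<inter> cball t r) \<subseteq> B \<and>
        m ` (V \<times> B) \<subseteq> U" if t: "t \<in> K" for t
    proof -
      have "f t \<in> topspace Z"
        using contf t K(2) by (auto simp: continuous_map_def)
      moreover have "m (c, f t) \<in> U"
      proof -
        have "?G p t \<in> U" using p(2) t by blast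
        then show ?thesis using t K(2) by (auto simp: p_def)
      qed
      ultimately have "(c, f t) \<in> {q \<in> topspace (prod_topology T Z). m q \<in> U}"
        using c by simp
      moreover have "openin (prod_topology T Z) {q \<in> topspace (prod_topology T Z). m q \<in> U}"
        using m U by (rule openin_continuous_map_preimage)
      ultimately obtain V B where VB: "openin T V" "openin Z B" "c \<in> V" "f t \<in> B"
          "V \<times> B \<subseteq> {q \<in> topspace (prod_topology T Z). m q \<in> U}"
        unfolding openin_prod_topology_alt by meson
      have "openin (top_of_set {0..1}) {u \<in> {0..1}. f u \<in> B}"
        using openin_continuous_map_preimage[OF contf VB(2)] by simp
      then obtain S where S: "open S" "{u \<in> {0..1}. f u \<in> B} = {0..1} \<inter> S"
        by (auto simp: openin_open)
      have "t \<in> S" using S(2) t K(2) VB(4) by blast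
      then obtain r where r: "0 < r" "cball t r \<subseteq> S"
        using S(1) by (meson open_contains_cball)
      have "f ` (K \<inter> cball t r) \<subseteq> B" using r(2) S(2) K(2) by blast
      moreover have "m ` (V \<times> B) \<subseteq> U" using VB(5) by blast
      ultimately show ?thesis using VB r by blast
    qed
    then obtain V B r where
      V: "\<And>t. t \<in> K \<Longrightarrow> openin T (V t) \<and> c \<in> V t \<and> openin Z (B t) \<and> (0::real) < r t"
      and fB: "\<And>t. t \<in> K \<Longrightarrow> f ` (K \<inter> cball t (r t)) \<subseteq> B t"
      and mU: "\<And>t. t \<in> K \<Longrightarrow> m ` (V t \<times> B t) \<subseteq> U"
      by metis
    have "K \<subseteq> (\<Union>t\<in>K. ball t (r t))" using V by force
    then obtain J where J: "J \<subseteq> K" "finite J" "K \<subseteq> (\<Union>t\<in>J. ball t (r t))"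
      using K(1) by (elim compactE_image) auto
    define N1 where "N1 = (\<Inter>t\<in>J. V t) \<inter> topspace T"
    define N2 where
      "N2 = (\<Inter>t\<in>J. {h \<in> path_space Z. h ` (K \<inter> cball t (r t)) \<subseteq> B t}) \<inter> path_space Z"
    have "openin T N1"
      unfolding N1_def using J V by (intro openin_INT) auto
    moreover have "openin (compact_open_top Z) N2"
    proof -
      have "openin (compact_open_top Z) {h \<in> path_space Z. h ` (K \<inter> cball t (r t)) \<subseteq> B t}"
        if "t \<in> J" for t
        using that J(1) V K by (intro openin_compact_open_top compact_Int) auto
      from openin_INT[OF J(2) this] show ?thesis by (simp add: N2_def)
    qed
    ultimately have "openin ?T (N1 \<times> N2)" by (simp add: openin_prod_Times_iff)
    moreover have "p \<in> N1 \<times> N2"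
      using c f V fB J(1) by (auto simp: p_def N1_def N2_def)
    moreover have "?G q ` K \<subseteq> U" if q: "q \<in> N1 \<times> N2" for q
    proof
      fix y assume "y \<in> ?G q ` K"
      then obtain u where u: "u \<in> K" "y = m (fst q, snd q u)"
        using K(2) by (auto simp: case_prod_beta)
      then obtain t where t: "t \<in> J" "u \<in> ball t (r t)" using J(3) by blast
      have "fst q \<in> V t" using q t(1) by (auto simp: N1_def)
      moreover have "snd q u \<in> B t" using q t u(1) by (force simp: N2_def)
      ultimately show "y \<in> U" using mU[of t] t(1) J(1) u(2) by blast
    qed
    ultimately show ?thesis by blast
  qed
  have "openin ?T (?G -` {h. h ` K \<subseteq> U} \<inter> topspace ?T)"
    if "compact K" "K \<subseteq> {0..1}" "openin W U" for K U
  proof (subst openin_subopen, intro ballI)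
    fix p assume "p \<in> ?G -` {h. h ` K \<subseteq> U} \<inter> topspace ?T"
    then have "p \<in> topspace ?T" "?G p ` K \<subseteq> U" by auto
    from nbhd[OF that this] obtain N where N: "openin ?T N" "p \<in> N" "\<forall>q\<in>N. ?G q ` K \<subseteq> U"
      by blast
    show "\<exists>N. openin ?T N \<and> p \<in> N \<and> N \<subseteq> ?G -` {h. h ` K \<subseteq> U} \<inter> topspace ?T"
      using N openin_subset[OF N(1)] by blast
  qed
  then show ?thesis
    using path
    unfolding compact_open_top_def[of W] continuous_map_in_subtopology
      continuous_on_generated_topo_iff
    by (auto intro!: exI[of _ "{}"])
qed

section \<open>Resolvable paths\<close>

lemma pushforward_Phi:
  "(\<lambda>t\<in>{0..1}. map_pmf g (Phi \<mu> t)) = Phi (map_pmf (\<lambda>\<alpha>. \<lambda>t\<in>{0..1}. g (\<alpha> t)) \<mu>)"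
  by (auto simp: Phi_def map_pmf_comp fun_eq_iff intro!: map_pmf_cong)

text \<open>
  Pushing paths forward may identify some of them but never splits one, so the measure on paths
  that resolves the image path obeys the same bound on the size of its support.
\<close>

lemma continuous_map_pushforward_resolvable:
  fixes g :: "'b::topological_space \<times> 'a::metric_space \<Rightarrow> 'c::metric_space"
  assumes g: "continuous_on (C \<times> X) g" "g ` (C \<times> X) \<subseteq> Y"
  shows "continuous_map (prod_topology (top_of_set C) (RP n X)) (RP n Y)
    (\<lambda>(c, f). \<lambda>t\<in>{0..1}. map_pmf (\<lambda>z. g (c, z)) (f t))"
    (is "continuous_map ?T _ ?G")
proof -
  let ?P = "prod_topology (top_of_set C) (compact_open_top (fin_measures_top n X))"
  have cont: "continuous_map ?P (compact_open_top (fin_measures_top n Y)) ?G"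
    using continuous_map_compose_paths[OF continuous_map_pushforward[OF g, of n]] by simp
  have T: "?T = subtopology ?P (C \<times> resolvable_paths n X)"
    unfolding RP_def by (simp add: prod_topology_subtopology(2) subtopology_subtopology
        prod_topology_subtopology(1) Times_Int_Times)
  have g': "continuous_map (prod_topology (top_of_set C) (top_of_set X)) (top_of_set Y) g"
    using g by (simp add: prod_topology_subtopology_eu continuous_map_in_subtopology image_subset_iff_funcset)
  have res: "?G (c, f) \<in> resolvable_paths n Y" if c: "c \<in> C" and f: "f \<in> resolvable_paths n X" for c f
  proof -
    obtain \<mu> where \<mu>: "\<mu> \<in> fin_measures n (path_space (top_of_set X))" "f = Phi \<mu>"
      using f by (auto simp: resolvable_paths_def)
    have "map_pmf (\<lambda>\<alpha>. \<lambda>t\<in>{0..1}. g (c, \<alpha> t)) \<mu> \<in> fin_measures n (path_space (top_of_set Y))"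
      using path_space_compose_family[OF g'] c by (intro map_pmf_in_fin_measures[OF \<mu>(1)]) auto
    moreover have "?G (c, f) = Phi (map_pmf (\<lambda>\<alpha>. \<lambda>t\<in>{0..1}. g (c, \<alpha> t)) \<mu>)"
      using pushforward_Phi[of "\<lambda>z. g (c, z)" \<mu>] by (simp add: \<mu>(2))
    moreover have "?G (c, f) \<in> path_space (fin_measures_top n Y)"
      using continuous_map_image_subset_topspace[OF cont] c f
      by (auto simp: resolvable_paths_def image_subset_iff)
    ultimately show ?thesis unfolding resolvable_paths_def by blast
  qed
  show ?thesis
    unfolding T unfolding RP_def continuous_map_in_subtopology
    using res by (auto intro: continuous_map_from_subtopology[OF cont])
qed

section \<open>Motion planners and contractions\<close>

lemma planner_imp_contraction:
  fixes X :: "'a::metric_space set"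
  assumes s: "continuous_map (prod_topology (top_of_set X) (top_of_set X)) (RP n X) s"
      "\<forall>x\<in>X. \<forall>y\<in>X. s (x, y) 0 = return_pmf x \<and> s (x, y) 1 = return_pmf y"
    and "x\<^sub>0 \<in> X"
  shows "\<exists>H. continuous_map (top_of_set X) (RP0 n X x\<^sub>0) H \<and> (\<forall>x\<in>X. H x 0 = return_pmf x)"
proof (intro exI conjI)
  have "continuous_map (top_of_set X) (prod_topology (top_of_set X) (top_of_set X)) (\<lambda>x. (x, x\<^sub>0))"
    using \<open>x\<^sub>0 \<in> X\<close> by (intro continuous_map_pairedI) auto
  from continuous_map_compose[OF this s(1)]
  show "continuous_map (top_of_set X) (RP0 n X x\<^sub>0) (\<lambda>x. s (x, x\<^sub>0))"
    unfolding RP0_def continuous_map_in_subtopology using s(2) \<open>x\<^sub>0 \<in> X\<close> by (auto simp: o_def)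
  show "\<forall>x\<in>X. s (x, x\<^sub>0) 0 = return_pmf x" using s(2) \<open>x\<^sub>0 \<in> X\<close> by blast
qed

lemma contraction_imp_planner:
  fixes x\<^sub>0 :: "'a::{metric_space, topological_group_add}"
  assumes H: "continuous_map euclidean (RP0 n UNIV x\<^sub>0) H" "\<And>x. H x 0 = return_pmf x"
  shows "\<exists>s. continuous_map (prod_topology euclidean euclidean) (RP n (UNIV :: 'a set)) s \<and>
    (\<forall>x y. s (x, y) 0 = return_pmf x \<and> s (x, y) 1 = return_pmf y)"
proof -
  define G :: "'a \<times> (real \<Rightarrow> 'a pmf) \<Rightarrow> real \<Rightarrow> 'a pmf"
    where "G = (\<lambda>(c, f). \<lambda>t\<in>{0..1}. map_pmf (\<lambda>z. z + c) (f t))"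
  define s where "s = (\<lambda>(x, y). G (- x\<^sub>0 + y, H (x - y + x\<^sub>0)))"
  have "continuous_on UNIV (\<lambda>q::'a \<times> 'a. snd q + fst q)"
    by (intro continuous_intros)
  then have G: "continuous_map (prod_topology euclidean (RP n UNIV)) (RP n UNIV) G"
    using continuous_map_pushforward_resolvable[of UNIV UNIV "\<lambda>q::'a \<times> 'a. snd q + fst q" UNIV n]
    by (simp add: G_def)
  have H_RP: "continuous_map euclidean (RP n UNIV) H" and H_end: "H x 1 = return_pmf x\<^sub>0" for x
    using H(1) unfolding RP0_def continuous_map_in_subtopology by auto
  have "continuous_on UNIV (\<lambda>p::'a \<times> 'a. - x\<^sub>0 + snd p)"
    by (intro continuous_intros)
  moreover have "continuous_on UNIV (\<lambda>p::'a \<times> 'a. fst p - snd p + x\<^sub>0)"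
    unfolding diff_conv_add_uminus by (intro continuous_intros)
  then have "continuous_map euclidean euclidean (\<lambda>p::'a \<times> 'a. fst p - snd p + x\<^sub>0)"
    by simp
  from continuous_map_compose[OF this H_RP]
  have "continuous_map euclidean (RP n UNIV) (\<lambda>p. H (fst p - snd p + x\<^sub>0))"
    by (simp add: o_def)
  ultimately have "continuous_map euclidean (prod_topology euclidean (RP n UNIV))
      (\<lambda>p. (- x\<^sub>0 + snd p, H (fst p - snd p + x\<^sub>0)))"
    by (intro continuous_map_pairedI) auto
  from continuous_map_compose[OF this G]
  have "continuous_map (prod_topology euclidean euclidean) (RP n UNIV) s"
    by (simp add: s_def o_def case_prod_unfold euclidean_product_topology)
  moreover have "s (x, y) 0 = return_pmf x" "s (x, y) 1 = return_pmf y" for x y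
    using H(2) H_end by (simp_all add: s_def G_def map_pmf_def bind_return_pmf add.assoc[symmetric])
  ultimately show ?thesis by blast
qed

theorem corollary4p21:
  fixes x\<^sub>0 :: "'a::{metric_space, topological_group_add}"
  assumes "path_connected (UNIV :: 'a set)"
    and "metrizable_ANR (euclidean :: 'a topology)"
  shows "iTC (UNIV :: 'a set) = icat (UNIV :: 'a set) x\<^sub>0"
proof -
  have "{n. \<exists>s. continuous_map (prod_topology (top_of_set UNIV) (top_of_set UNIV))
          (RP (n + 1) (UNIV :: 'a set)) s \<and>
        (\<forall>x\<in>UNIV. \<forall>y\<in>UNIV. s (x, y) 0 = return_pmf x \<and> s (x, y) 1 = return_pmf y)} =
      {n. \<exists>H. continuous_map (top_of_set UNIV) (RP0 (n + 1) UNIV x\<^sub>0) H \<and>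
        (\<forall>x\<in>UNIV. H x 0 = return_pmf x)}" (is "Collect ?A = Collect ?B")
  proof (intro Collect_cong iffI)
    fix n
    show "?B n" if "?A n"
      using that planner_imp_contraction[OF _ _ UNIV_I] by blast
    show "?A n" if "?B n"
    proof -
      from that obtain H where "continuous_map euclidean (RP0 (n + 1) UNIV x\<^sub>0) H"
          "\<And>x. H x 0 = return_pmf x"
        by auto
      from contraction_imp_planner[OF this] show ?thesis by simp
    qed
  qed
  then show ?thesis unfolding iTC_def icat_def by (rule arg_cong)
qed

end
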